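(* Under the standing assumptions A1--A4 (see context), let $\bar u\in\operatorname{dom}g$ and suppose that $\bar u$ satisfies the Polyak--Łojasiewicz--Kurdyka property with $X\in\{Y,\mathcal U^*\}$ and constants $R,\lambda,\eta>0$, i.e. $$J(u)-J(\bar u)\le\frac\lambda2\inf\{\|\nabla f(u)+\xi\|_X^2\mid\xi\in\partial g(u)\cap X\}\qquad\forall u\in B_R(\bar u)\text{ with }J(u)\le J(\bar u)+\eta,$$ and that $\bar u$ is a strict minimizer of $J$ on $B_R(\bar u)$. In case $X=Y$, assume further that for all $u,z\in\operatorname{dom}g$, $\alpha>0$ and $y\in Y$ such that $u$ is a minimizer of the functional $\langle y,\cdot\rangle+g+\alpha\|\cdot-z\|_{\mathcal U}$, there exist $\xi\in\partial g(u)\cap Y$ and $\zeta\in\partial\|\cdot\|_{\mathcal U}(u-z)\cap Y$ such that $0=y+\xi+\alpha\zeta$. Then quadratic growth holds with radius $\bar R=R/2$, $\theta=\min\{1/\lambda,\ 2\eta/\bar R^2\}$ and $\eta$, i.e. $$\frac\theta2\|u-\bar u\|_{\mathcal U}^2\le J(u)-J(\bar u)\qquad\forall u\in B_{\bar R}(\bar u)\text{ with }J(u)\le J(\bar u)+\eta.$$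
   Context: Standing assumptions. (A1) $\mathcal U\cong Y^*$, where $Y$ is a separable Banach space with norm $\|\cdot\|_Y$; $\langle\cdot,\cdot\rangle$ is the pairing between $Y$ and $\mathcal U$, and $\mathcal U$ carries the dual norm $\|u\|_{\mathcal U}=\sup_{\|y\|_Y\le1}\langle y,u\rangle$. (A2) $g:\mathcal U\to[0,\infty]$ is proper, convex and sequentially weak* lower semicontinuous. (A3) $f:\mathcal U\to[0,\infty)$ is sequentially weak* lower semicontinuous on $\operatorname{dom}g$, and there are a neighborhood $\mathcal N$ of $\operatorname{dom}g$ in $\mathcal U$ and a map $\nabla f:\operatorname{dom}g\to Y$ such that $f$ is Gâteaux differentiable on $\mathcal N$ with $f'(u)(\delta u)=\langle\nabla f(u),\delta u\rangle$ for all $u\in\operatorname{dom}g$, $\delta u\in\mathcal U$; moreover there is $L_{\nabla f}\ge0$ with $\|\nabla f(u_1)-\nabla f(u_2)\|_Y\le L_{\nabla f}\|u_1-u_2\|_{\mathcal U}$ for all $u_1,u_2\in\operatorname{dom}g$. (A4) With $J:=f+g$: if $\|u_k\|_{\mathcal U}\to\infty$ then $J(u_k)\to\infty$. $\mathcal U^*$ is the dual of $\mathcal U$ with its canonical norm; $Y$ is regarded as a subspace of $\mathcal U^*=Y^{**}$ via the canonical isometric embedding; $\partial$ denotes the convex subdifferential, a subset of $\mathcal U^*$. $B_r(\bar u)$ is the closed ball of radius $r$ around $\bar u$ in $\mathcal U$. The infimum over the empty set is $+\infty$. "Strict minimizer on $B_R(\bar u)$" means $J(u)>J(\bar u)$ for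 all $u\in B_R(\bar u)\setminus\{\bar u\}$. *)

theory Defs
  imports "HOL-Analysis.Analysis"
begin

(* The space U is a type 'u together with a map \<iota> identifying it with the dual 'y \<Rightarrow>\<^sub>L real of
   the predual Y = 'y; the pairing <y, u> is \<iota> u y.
   Demanding the class banach of 'u is no restriction, since a dual space is complete. *)
definition dual_of_separable :: "('u::banach \<Rightarrow> ('y::banach \<Rightarrow>\<^sub>L real)) \<Rightarrow> bool" where
  "dual_of_separable \<iota> \<longleftrightarrow>
     separable_space (euclidean :: 'y topology) \<and>
     linear \<iota> \<and> bij \<iota> \<and>
     (\<forall>u. norm u = (SUP y\<in>cball 0 1. blinfun_apply (\<iota> u) y))"

(* The canonical embedding of Y into U*. The argument of Blinfun is bounded linear
   whenever dual_of_separable \<iota> holds. *)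
definition embed :: "('u::banach \<Rightarrow> ('y::banach \<Rightarrow>\<^sub>L real)) \<Rightarrow> 'y \<Rightarrow> ('u \<Rightarrow>\<^sub>L real)" where
  "embed \<iota> y = Blinfun (\<lambda>u. blinfun_apply (\<iota> u) y)"

definition weakstar_tendsto ::
  "('u::banach \<Rightarrow> ('y::banach \<Rightarrow>\<^sub>L real)) \<Rightarrow> (nat \<Rightarrow> 'u) \<Rightarrow> 'u \<Rightarrow> bool" where
  "weakstar_tendsto \<iota> v u \<longleftrightarrow>
     (\<forall>y. (\<lambda>k. blinfun_apply (\<iota> (v k)) y) \<longlonglongrightarrow> blinfun_apply (\<iota> u) y)"

definition seq_weakstar_lsc_on ::
  "('u::banach \<Rightarrow> ('y::banach \<Rightarrow>\<^sub>L real)) \<Rightarrow> 'u set \<Rightarrow> ('u \<Rightarrow> ereal) \<Rightarrow> bool" where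
  "seq_weakstar_lsc_on \<iota> S h \<longleftrightarrow>
     (\<forall>v u. range v \<subseteq> S \<longrightarrow> u \<in> S \<longrightarrow> weakstar_tendsto \<iota> v u \<longrightarrow> h u \<le> liminf (\<lambda>k. h (v k)))"

definition effective_domain :: "('u \<Rightarrow> ereal) \<Rightarrow> 'u set" where
  "effective_domain g = {u. g u < \<infinity>}"

definition convex_ereal :: "('u::real_vector \<Rightarrow> ereal) \<Rightarrow> bool" where
  "convex_ereal g \<longleftrightarrow>
     (\<forall>u v t. 0 \<le> t \<longrightarrow> t \<le> 1 \<longrightarrow>
        g ((1 - t) *\<^sub>R u + t *\<^sub>R v) \<le> ereal (1 - t) * g u + ereal t * g v)"

(* For proper g and g u = \<infinity> the set is empty. *)
definition subdifferential :: "('u::banach \<Rightarrow> ereal) \<Rightarrow> 'u \<Rightarrow> ('u \<Rightarrow>\<^sub>L real) set" where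
  "subdifferential g u = {\<xi>. \<forall>v. g u + ereal (blinfun_apply \<xi> (v - u)) \<le> g v}"

definition has_gateaux_derivative :: "('u::banach \<Rightarrow> real) \<Rightarrow> ('u \<Rightarrow>\<^sub>L real) \<Rightarrow> 'u \<Rightarrow> bool" where
  "has_gateaux_derivative f f' u \<longleftrightarrow>
     (\<forall>h. ((\<lambda>t. (f (u + t *\<^sub>R h) - f u) / t) \<longlongrightarrow> blinfun_apply f' h) (at 0))"

definition assumption_g :: "('u::banach \<Rightarrow> ('y::banach \<Rightarrow>\<^sub>L real)) \<Rightarrow> ('u \<Rightarrow> ereal) \<Rightarrow> bool" where
  "assumption_g \<iota> g \<longleftrightarrow>
     (\<forall>u. 0 \<le> g u) \<and> effective_domain g \<noteq> {} \<and> convex_ereal g \<and> seq_weakstar_lsc_on \<iota> UNIV g"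

(* The values of gradf outside effective_domain g are irrelevant. *)
definition assumption_f ::
  "('u::banach \<Rightarrow> ('y::banach \<Rightarrow>\<^sub>L real)) \<Rightarrow> ('u \<Rightarrow> real) \<Rightarrow> ('u \<Rightarrow> ereal) \<Rightarrow> ('u \<Rightarrow> 'y) \<Rightarrow> bool" where
  "assumption_f \<iota> f g gradf \<longleftrightarrow>
     (\<forall>u. 0 \<le> f u) \<and>
     seq_weakstar_lsc_on \<iota> (effective_domain g) (\<lambda>u. ereal (f u)) \<and>
     (\<exists>N. effective_domain g \<subseteq> interior N \<and> (\<forall>u\<in>N. \<exists>f'. has_gateaux_derivative f f' u)) \<and>
     (\<forall>u\<in>effective_domain g. has_gateaux_derivative f (embed \<iota> (gradf u)) u) \<and>
     (\<exists>L. L-lipschitz_on (effective_domain g) gradf)"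

definition objective :: "('u \<Rightarrow> real) \<Rightarrow> ('u \<Rightarrow> ereal) \<Rightarrow> 'u \<Rightarrow> ereal" where
  "objective f g u = ereal (f u) + g u"

definition coercive :: "('u::banach \<Rightarrow> ereal) \<Rightarrow> bool" where
  "coercive J \<longleftrightarrow>
     (\<forall>v::nat \<Rightarrow> 'u. filterlim (\<lambda>k. norm (v k)) at_top sequentially \<longrightarrow> (\<lambda>k. J (v k)) \<longlonglongrightarrow> \<infinity>)"

(* The choice X = Y or X = U*. This is a tag rather than a subset of U* so that the two
   cases stay distinct when Y is reflexive. *)
datatype space_choice = Predual | Dual

(* inf {norm (gradf u + \<xi>)^2 | \<xi> \<in> subdifferential g u \<inter> X}, with the norm of X;
   it is \<infinity> if the set is empty. *)
definition slope_sq ::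
  "('u::banach \<Rightarrow> ('y::banach \<Rightarrow>\<^sub>L real)) \<Rightarrow> space_choice \<Rightarrow> ('u \<Rightarrow> ereal) \<Rightarrow> ('u \<Rightarrow> 'y) \<Rightarrow> 'u \<Rightarrow> ereal" where
  "slope_sq \<iota> X g gradf u =
     (case X of
        Predual \<Rightarrow> (INF y\<in>{y. embed \<iota> y \<in> subdifferential g u}. ereal ((norm (gradf u + y))\<^sup>2))
      | Dual \<Rightarrow> (INF \<xi>\<in>subdifferential g u. ereal ((norm (embed \<iota> (gradf u) + \<xi>))\<^sup>2)))"

definition PLK ::
  "('u::banach \<Rightarrow> ('y::banach \<Rightarrow>\<^sub>L real)) \<Rightarrow> space_choice \<Rightarrow> ('u \<Rightarrow> real) \<Rightarrow> ('u \<Rightarrow> ereal) \<Rightarrow> ('u \<Rightarrow> 'y) \<Rightarrow>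
     'u \<Rightarrow> real \<Rightarrow> real \<Rightarrow> real \<Rightarrow> bool" where
  "PLK \<iota> X f g gradf ubar R lam \<eta> \<longleftrightarrow>
     (\<forall>u\<in>cball ubar R. objective f g u \<le> objective f g ubar + ereal \<eta> \<longrightarrow>
        objective f g u - objective f g ubar \<le> ereal (lam / 2) * slope_sq \<iota> X g gradf u)"

definition strict_minimizer_on :: "'u set \<Rightarrow> ('u \<Rightarrow> ereal) \<Rightarrow> 'u \<Rightarrow> bool" where
  "strict_minimizer_on S J ubar \<longleftrightarrow> (\<forall>u\<in>S - {ubar}. J ubar < J u)"

definition predual_sum_rule :: "('u::banach \<Rightarrow> ('y::banach \<Rightarrow>\<^sub>L real)) \<Rightarrow> ('u \<Rightarrow> ereal) \<Rightarrow> bool" where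
  "predual_sum_rule \<iota> g \<longleftrightarrow>
     (\<forall>u\<in>effective_domain g. \<forall>z\<in>effective_domain g. \<forall>\<alpha>>0. \<forall>y.
        (\<forall>v. ereal (blinfun_apply (\<iota> u) y) + g u + ereal (\<alpha> * norm (u - z))
             \<le> ereal (blinfun_apply (\<iota> v) y) + g v + ereal (\<alpha> * norm (v - z))) \<longrightarrow>
        (\<exists>\<xi> \<zeta>. embed \<iota> \<xi> \<in> subdifferential g u \<and>
               embed \<iota> \<zeta> \<in> subdifferential (\<lambda>v. ereal (norm v)) (u - z) \<and>
               0 = y + \<xi> + \<alpha> *\<^sub>R \<zeta>))"

definition quadratic_growth :: "('u::banach \<Rightarrow> ereal) \<Rightarrow> 'u \<Rightarrow> real \<Rightarrow> real \<Rightarrow> real \<Rightarrow> bool" where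
  "quadratic_growth J ubar R \<theta> \<eta> \<longleftrightarrow>
     (\<forall>u\<in>cball ubar R. J u \<le> J ubar + ereal \<eta> \<longrightarrow>
        ereal (\<theta> / 2 * (norm (u - ubar))\<^sup>2) \<le> J u - J ubar)"

end

theory Submission
  imports Defs
begin

text \<open>
  The Polyak-Lojasiewicz-Kurdyka inequality says that the square root
  \<open>\<phi> = sqrt (J - J ubar)\<close> is steep: if \<open>|\<partial>J|\<close> denotes the infimal norm in
  \<open>gradf u + \<partial>g u\<close>, then the slope \<open>|\<partial>J| / (2 * \<phi>)\<close> of \<open>\<phi>\<close> is at least
  \<open>1 / sqrt (2 * lam)\<close> wherever the inequality applies and \<open>\<phi> > 0\<close>. A nonnegative lower
  semicontinuous function on a complete space whose slope is at least \<open>\<alpha>\<close> at all points where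
  it is positive dominates \<open>\<alpha>\<close> times the distance to its zero set, so
  \<open>\<phi> u \<ge> norm (u - ubar) / sqrt (2 * lam)\<close>, and squaring gives quadratic growth.

  The domination argument is Ekeland's variational principle (\<open>Ekeland\<close>). Suppose that
  \<open>\<phi> u0 < \<alpha> * r\<close> with \<open>r = norm (u0 - ubar) \<le> R / 2\<close> and \<open>\<alpha> < 1 / sqrt (2 * lam)\<close>. The principle
  yields \<open>u\<close> with \<open>norm (u - u0) < r\<close> that minimizes \<open>\<phi> + \<alpha> * norm (\<cdot> - u)\<close>. The distance bound
  keeps \<open>u\<close> away from \<open>ubar\<close>, so that \<open>\<phi> u > 0\<close> by strict minimality, and inside the open ball of
  radius \<open>R\<close>. Squaring near \<open>u\<close> shows that \<open>u\<close> is a local minimizer of \<open>J + b * norm (\<cdot> - u)\<close>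
  with \<open>b = 2 * \<alpha> * \<phi> u\<close>. Since \<open>g\<close> is convex, \<open>f\<close> may be replaced by its linearization
  (\<open>linearized_minimality\<close>) and the minimality becomes global; a sum rule for the subdifferential
  then shows that \<open>gradf u + \<partial>g u\<close> has an element of norm at most \<open>b\<close> (\<open>slope_sq_le\<close>). Now
  \<open>\<phi> u ^ 2 \<le> lam / 2 * b ^ 2 = 2 * lam * \<alpha> ^ 2 * \<phi> u ^ 2 < \<phi> u ^ 2\<close>, a contradiction.

  The Hahn-Banach theorem enters twice. For slopes measured in the dual of the space it gives the
  sum rule itself, in the form of a linear functional squeezed between a convex function and a
  multiple of \<open>- norm\<close> (\<open>convex_sandwich_norm\<close>). For slopes measured in the predual, the sum rule
  is the hypothesis \<open>predual_sum_rule\<close>, and Hahn-Banach only ensures that the predual embeds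
  isometrically, so that the predual element \<open>\<zeta>\<close> it provides has norm at most one
  (\<open>norm_predual_le_1\<close>).
\<close>

section \<open>The Hahn-Banach theorem\<close>

definition sublinear :: "('a::real_vector \<Rightarrow> real) \<Rightarrow> bool" where
  "sublinear p \<longleftrightarrow>
     (\<forall>x y. p (x + y) \<le> p x + p y) \<and> (\<forall>c>0. \<forall>x. p (c *\<^sub>R x) = c * p x)"

lemma sublinear_add: "sublinear p \<Longrightarrow> p (x + y) \<le> p x + p y"
  by (simp add: sublinear_def)

lemma sublinear_zero:
  assumes "sublinear p"
  shows "p 0 = 0"
proof -
  have "p (2 *\<^sub>R 0) = 2 * p 0"
    using assms unfolding sublinear_def by (metis zero_less_numeral)
  then show ?thesis by simp
qed

lemma sublinear_scale:
  assumes "sublinear p" "0 \<le> c"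
  shows "p (c *\<^sub>R x) = c * p x"
  using assms sublinear_zero[OF assms(1)] by (cases "c = 0") (auto simp: sublinear_def)

lemma sublinear_minus: "sublinear p \<Longrightarrow> - p (- x) \<le> p x"
  using sublinear_add[of p x "- x"] sublinear_zero[of p] by simp

lemma sublinear_norm: "sublinear norm"
  by (simp add: sublinear_def norm_triangle_ineq)

text \<open>
  The common pattern behind pointwise infima of chains, tilting, and inf-convolution with a norm:
  members of \<open>A x\<close> and \<open>A y\<close> combine to a member of \<open>A (x + y)\<close> that is no larger than their sum,
  and scaling up and down again turns the inequality for multiples into an equality.
\<close>

lemma sublinear_Inf:
  fixes A :: "'a::real_vector \<Rightarrow> real set"
  assumes ne: "\<And>x. A x \<noteq> {}" and bdd: "\<And>x. bdd_below (A x)"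
    and add: "\<And>x y a b. a \<in> A x \<Longrightarrow> b \<in> A y \<Longrightarrow> \<exists>d\<in>A (x + y). d \<le> a + b"
    and scale: "\<And>x a c. a \<in> A x \<Longrightarrow> 0 < c \<Longrightarrow> \<exists>d\<in>A (c *\<^sub>R x). d \<le> c * a"
  shows "sublinear (\<lambda>x. Inf (A x))"
proof -
  have le: "Inf (A (c *\<^sub>R x)) \<le> c * Inf (A x)" if "0 < c" for c x
  proof -
    have "Inf (A (c *\<^sub>R x)) / c \<le> a" if a: "a \<in> A x" for a
    proof -
      obtain d where d: "d \<in> A (c *\<^sub>R x)" "d \<le> c * a"
        using scale[OF a \<open>0 < c\<close>] by blast
      then have "Inf (A (c *\<^sub>R x)) \<le> c * a"
        using cInf_lower[OF d(1) bdd] by linarith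
      then show ?thesis using \<open>0 < c\<close> by (simp add: field_simps)
    qed
    then have "Inf (A (c *\<^sub>R x)) / c \<le> Inf (A x)"
      by (intro cInf_greatest ne)
    then show ?thesis using \<open>0 < c\<close> by (simp add: field_simps)
  qed
  have "Inf (A (c *\<^sub>R x)) = c * Inf (A x)" if "0 < c" for c x
  proof (rule antisym)
    show "Inf (A (c *\<^sub>R x)) \<le> c * Inf (A x)" by (rule le[OF that])
    have "Inf (A ((1 / c) *\<^sub>R (c *\<^sub>R x))) \<le> (1 / c) * Inf (A (c *\<^sub>R x))"
      using that by (intro le) simp
    then show "c * Inf (A x) \<le> Inf (A (c *\<^sub>R x))"
      using that by (simp add: field_simps)
  qed
  moreover have "Inf (A (x + y)) \<le> Inf (A x) + Inf (A y)" for x y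
  proof -
    have 1: "Inf (A (x + y)) - a \<le> Inf (A y)" if a: "a \<in> A x" for a
    proof (rule cInf_greatest[OF ne])
      fix b assume "b \<in> A y"
      then obtain d where "d \<in> A (x + y)" "d \<le> a + b" using add[OF a] by blast
      then show "Inf (A (x + y)) - a \<le> b" using cInf_lower[OF _ bdd, of d "x + y"] by linarith
    qed
    have "Inf (A (x + y)) - Inf (A y) \<le> Inf (A x)"
      by (rule cInf_greatest[OF ne]) (use 1 in force)
    then show ?thesis by linarith
  qed
  ultimately show ?thesis by (simp add: sublinear_def)
qed

text \<open>
  Tilting \<open>p\<close> at \<open>x\<close> gives a sublinear function below \<open>p\<close> whose value at \<open>- x\<close> is at most
  \<open>- p x\<close> (take \<open>t = 1\<close>). It shows that a minimal sublinear function is linear, and makes a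
  dominated linear functional attain the value of \<open>p\<close> at a prescribed point.
\<close>

definition tilt :: "('a::real_vector \<Rightarrow> real) \<Rightarrow> 'a \<Rightarrow> 'a \<Rightarrow> real" where
  "tilt p x y = Inf {p (y + t *\<^sub>R x) - t * p x | t. 0 \<le> t}"

lemma tilt_bdd:
  assumes "sublinear p"
  shows "bdd_below {p (y + t *\<^sub>R x) - t * p x | t. 0 \<le> t}"
proof (rule bdd_belowI[of _ "- p (- y)"])
  fix a assume "a \<in> {p (y + t *\<^sub>R x) - t * p x | t. 0 \<le> t}"
  then obtain t where t: "a = p (y + t *\<^sub>R x) - t * p x" "0 \<le> t" by blast
  show "- p (- y) \<le> a"
    using sublinear_add[OF assms, of "y + t *\<^sub>R x" "- y"] sublinear_scale[OF assms t(2), of x] t(1)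
    by simp
qed

lemma tilt_le:
  assumes "sublinear p" "0 \<le> t"
  shows "tilt p x y \<le> p (y + t *\<^sub>R x) - t * p x"
  unfolding tilt_def using assms by (intro cInf_lower tilt_bdd) auto

lemma sublinear_tilt:
  assumes "sublinear p"
  shows "sublinear (tilt p x)"
  unfolding tilt_def
proof (rule sublinear_Inf)
  fix y show "{p (y + t *\<^sub>R x) - t * p x | t. 0 \<le> t} \<noteq> {}" by (auto intro: exI[of _ 0])
  show "bdd_below {p (y + t *\<^sub>R x) - t * p x | t. 0 \<le> t}" by (rule tilt_bdd[OF assms])
next
  fix y z a b
  assume "a \<in> {p (y + t *\<^sub>R x) - t * p x | t. 0 \<le> t}" "b \<in> {p (z + t *\<^sub>R x) - t * p x | t. 0 \<le> t}"
  then obtain t s where ts: "0 \<le> t" "0 \<le> s"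
    "a = p (y + t *\<^sub>R x) - t * p x" "b = p (z + s *\<^sub>R x) - s * p x" by blast
  have "p ((y + z) + (t + s) *\<^sub>R x) - (t + s) * p x \<le> a + b"
    using sublinear_add[OF assms, of "y + t *\<^sub>R x" "z + s *\<^sub>R x"] ts
    by (simp add: algebra_simps)
  then show "\<exists>d\<in>{p ((y + z) + t *\<^sub>R x) - t * p x | t. 0 \<le> t}. d \<le> a + b"
    using ts by (metis (mono_tags, lifting) add_nonneg_nonneg mem_Collect_eq)
next
  fix y a and c :: real
  assume "a \<in> {p (y + t *\<^sub>R x) - t * p x | t. 0 \<le> t}" and c: "0 < c"
  then obtain t where t: "0 \<le> t" "a = p (y + t *\<^sub>R x) - t * p x" by blast
  have "p (c *\<^sub>R y + (c * t) *\<^sub>R x) - (c * t) * p x = c * a"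
    using sublinear_scale[OF assms, of c "y + t *\<^sub>R x"] c t(2)
    by (simp add: scaleR_add_right right_diff_distrib)
  then show "\<exists>d\<in>{p (c *\<^sub>R y + t *\<^sub>R x) - t * p x | t. 0 \<le> t}. d \<le> c * a"
    using t c by (metis (mono_tags, lifting) less_imp_le mult_nonneg_nonneg mem_Collect_eq order_refl)
qed

text \<open>
  Minimality makes every tilt of \<open>q\<close> equal to \<open>q\<close>, and the term \<open>t = 1\<close> in the infimum then
  reads \<open>q y \<le> q (y + x) - q x\<close>, the reverse of subadditivity.
\<close>

lemma minimal_sublinear_linear:
  assumes q: "sublinear q" and min: "\<And>r. sublinear r \<Longrightarrow> r \<le> q \<Longrightarrow> r = q"
  shows "linear q"
proof -
  have "tilt q x = q" for x
    by (rule min[OF sublinear_tilt[OF q]])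
       (use tilt_le[OF q order_refl, of x] in \<open>simp add: le_fun_def\<close>)
  then have add: "q (y + x) = q y + q x" for x y
    using tilt_le[OF q zero_le_one, of x y] sublinear_add[OF q, of y x] by simp
  have neg: "q (- x) = - q x" for x
    using add[of x "- x"] sublinear_zero[OF q] by simp
  show ?thesis
  proof (rule linearI)
    fix c x
    show "q (c *\<^sub>R x) = c *\<^sub>R q x"
    proof (cases "0 \<le> c")
      case True then show ?thesis using sublinear_scale[OF q] by simp
    next
      case False
      then show ?thesis using sublinear_scale[OF q, of "- c" x] neg[of "c *\<^sub>R x"] by simp
    qed
  qed (simp add: add)
qed

lemma sublinear_Inf_chain:
  assumes sub: "\<And>q. q \<in> C \<Longrightarrow> sublinear q \<and> q \<le> p" and "C \<noteq> {}"
    and chain: "\<And>q r. q \<in> C \<Longrightarrow> r \<in> C \<Longrightarrow> q \<le> r \<or> r \<le> q"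
  shows "sublinear (\<lambda>x. Inf ((\<lambda>q. q x) ` C)) \<and> (\<forall>q\<in>C. (\<lambda>x. Inf ((\<lambda>q. q x) ` C)) \<le> q)"
proof
  have bdd: "bdd_below ((\<lambda>q. q x) ` C)" for x
  proof (rule bdd_belowI2[of _ "- p (- x)"])
    fix q assume "q \<in> C"
    then show "- p (- x) \<le> q x"
      using sub[of q] sublinear_minus[of q x] by (auto simp: le_fun_def) (smt (verit))
  qed
  show "sublinear (\<lambda>x. Inf ((\<lambda>q. q x) ` C))"
  proof (rule sublinear_Inf)
    fix x y a b assume "a \<in> (\<lambda>q. q x) ` C" "b \<in> (\<lambda>q. q y) ` C"
    then obtain q r where qr: "q \<in> C" "r \<in> C" "a = q x" "b = r y" by auto
    then have "q (x + y) \<le> a + b \<or> r (x + y) \<le> a + b"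
      using chain[OF qr(1,2)] sub[OF qr(1)] sub[OF qr(2)]
        sublinear_add[of q x y] sublinear_add[of r x y]
      by (auto simp: le_fun_def) (smt (verit))+
    then show "\<exists>d\<in>(\<lambda>q. q (x + y)) ` C. d \<le> a + b" using qr by blast
  next
    fix x a and c :: real assume "a \<in> (\<lambda>q. q x) ` C" "0 < c"
    then show "\<exists>d\<in>(\<lambda>q. q (c *\<^sub>R x)) ` C. d \<le> c * a"
      using sub sublinear_scale by (smt (verit) image_iff)
  qed (use bdd \<open>C \<noteq> {}\<close> in auto)
  show "\<forall>q\<in>C. (\<lambda>x. Inf ((\<lambda>q. q x) ` C)) \<le> q"
    using bdd by (auto simp: le_fun_def intro!: cINF_lower)
qed

text \<open>
  Zorn's lemma is applied to the sublinear functions below \<open>p\<close>, not to partially defined linear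
  functionals, so that no one-dimensional extension step is needed.
\<close>

theorem Hahn_Banach_sublinear:
  assumes p: "sublinear p"
  obtains l where "linear l" "\<And>x. l x \<le> p x"
proof -
  let ?A = "{q. sublinear q \<and> q \<le> p}"
  have "\<exists>q\<in>?A. \<forall>r\<in>?A. r \<le> q \<longrightarrow> r = q"
  proof (rule predicate_Zorn[where P = "\<lambda>q r. r \<le> q"])
    show "partial_order_on ?A (relation_of (\<lambda>q r. r \<le> q) ?A)"
      by (rule partial_order_on_relation_ofI) auto
    fix C assume C: "C \<in> Chains (relation_of (\<lambda>q r. r \<le> q) ?A)"
    show "\<exists>u\<in>?A. \<forall>a\<in>C. u \<le> a"
    proof (cases "C = {}")
      case True then show ?thesis using p by auto
    next
      case False
      have CA: "q \<in> C \<Longrightarrow> sublinear q \<and> q \<le> p" for q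
        using C by (auto simp: Chains_def relation_of_def)
      have ch: "q \<in> C \<Longrightarrow> r \<in> C \<Longrightarrow> q \<le> r \<or> r \<le> q" for q r
        using C by (auto simp: Chains_def relation_of_def)
      obtain q where "q \<in> C" using False by blast
      then show ?thesis
        using sublinear_Inf_chain[OF CA False ch] CA[of q] order_trans by blast
    qed
  qed
  then obtain q where q: "sublinear q" "q \<le> p" "\<And>r. sublinear r \<Longrightarrow> r \<le> p \<Longrightarrow> r \<le> q \<Longrightarrow> r = q"
    by blast
  have "linear q" using minimal_sublinear_linear[OF q(1)] q(2,3) order_trans by blast
  then show thesis using that q(2) by (auto simp: le_fun_def)
qed

text \<open>
  Domination by the tilt of the norm at \<open>y\<close>, instead of by the norm, forces
  \<open>l (- y) \<le> - norm y\<close>.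
\<close>

lemma norming_functional:
  fixes y :: "'a::real_normed_vector"
  obtains l :: "'a \<Rightarrow>\<^sub>L real" where "norm l \<le> 1" "blinfun_apply l y = norm y"
proof -
  have n: "sublinear (norm :: 'a \<Rightarrow> real)" by (rule sublinear_norm)
  obtain l where l: "linear l" "\<And>x. l x \<le> tilt norm y x"
    using Hahn_Banach_sublinear[OF sublinear_tilt[OF n]] by blast
  have le: "l x \<le> norm x" for x
    using l(2)[of x] tilt_le[OF n order_refl, of y x] by simp
  have abs: "\<bar>l x\<bar> \<le> norm x" for x
    using le[of x] le[of "- x"] linear_neg[OF l(1), of x] by simp
  have bl: "bounded_linear l"
    using l(1) abs by (intro bounded_linear_intro[of _ 1]) (auto simp: linear_add linear_scale)
  have "l (- y) \<le> - norm y" using l(2)[of "- y"] tilt_le[OF n zero_le_one, of y "- y"] by simp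
  then have "l y = norm y" using le[of y] linear_neg[OF l(1), of y] by simp
  moreover have "norm (Blinfun l) \<le> 1"
    by (rule norm_blinfun_bound) (use bl abs in \<open>auto simp: bounded_linear_Blinfun_apply\<close>)
  ultimately show thesis
    using that[of "Blinfun l"] bl by (simp add: bounded_linear_Blinfun_apply)
qed

text \<open>
  Hahn-Banach is applied to the largest sublinear function below both \<open>\<phi>\<close> and \<open>b * norm\<close>,
  the inf-convolution of the positively homogeneous hull of \<open>\<phi>\<close> with \<open>b * norm\<close>. The lower
  bound on \<open>\<phi>\<close> is what keeps this infimum finite.
\<close>

lemma convex_sandwich_norm:
  fixes \<phi> :: "'a::real_normed_vector \<Rightarrow> real"
  assumes conv: "convex_on D \<phi>" and D0: "0 \<in> D" and \<phi>0: "\<phi> 0 = 0"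
    and b: "0 \<le> b" and lower: "\<And>h. h \<in> D \<Longrightarrow> - b * norm h \<le> \<phi> h"
  obtains l :: "'a \<Rightarrow>\<^sub>L real" where "norm l \<le> b" "\<And>h. h \<in> D \<Longrightarrow> blinfun_apply l h \<le> \<phi> h"
proof -
  define A where "A x = {t * \<phi> k + b * norm (x - t *\<^sub>R k) | t k. 0 < t \<and> k \<in> D}" for x
  have memA: "t * \<phi> k + b * norm (x - t *\<^sub>R k) \<in> A x" if "0 < t" "k \<in> D" for t k x
    using that A_def by blast
  have bdd: "bdd_below (A x)" for x
  proof (rule bdd_belowI[of _ "- b * norm x"])
    fix a assume "a \<in> A x"
    then obtain t k where tk: "0 < t" "k \<in> D" "a = t * \<phi> k + b * norm (x - t *\<^sub>R k)"
      unfolding A_def by blast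
    have "t * (- b * norm k) \<le> t * \<phi> k" using lower[OF tk(2)] tk(1) by (intro mult_left_mono) auto
    moreover have "b * norm (t *\<^sub>R k) \<le> b * (norm x + norm (x - t *\<^sub>R k))"
      using norm_triangle_sub[of "t *\<^sub>R k" x] b by (intro mult_left_mono) (auto simp: norm_minus_commute)
    ultimately show "- b * norm x \<le> a" using tk by (simp add: algebra_simps)
  qed
  have sub: "sublinear (\<lambda>x. Inf (A x))"
  proof (rule sublinear_Inf)
    fix x show "A x \<noteq> {}" using memA[OF zero_less_one D0] by blast
    show "bdd_below (A x)" by (rule bdd)
  next
    fix x y a c assume "a \<in> A x" "c \<in> A y"
    then obtain t k s m where *: "0 < t" "k \<in> D" "a = t * \<phi> k + b * norm (x - t *\<^sub>R k)"
      "0 < s" "m \<in> D" "c = s * \<phi> m + b * norm (y - s *\<^sub>R m)"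
      unfolding A_def by blast
    \<comment> \<open>The perspectives \<open>t * \<phi> k\<close> and \<open>s * \<phi> m\<close> add up to at least the perspective at this convex
       combination, with weight \<open>t + s\<close>.\<close>
    define w where "w = (t / (t + s)) *\<^sub>R k + (s / (t + s)) *\<^sub>R m"
    have ts: "t / (t + s) + s / (t + s) = 1"
      using * by (simp add: add_divide_distrib[symmetric])
    have w: "w \<in> D"
      unfolding w_def using convex_on_imp_convex[OF conv] * ts by (intro convexD) auto
    have "\<phi> w \<le> t / (t + s) * \<phi> k + s / (t + s) * \<phi> m"
      unfolding w_def using * ts
      by (intro conv[unfolded convex_on_def, THEN conjunct2, rule_format]) auto
    then have "(t + s) * \<phi> w \<le> (t + s) * (t / (t + s) * \<phi> k + s / (t + s) * \<phi> m)"
      using * by (intro mult_left_mono) auto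
    also have "\<dots> = t * \<phi> k + s * \<phi> m" using * by (simp add: distrib_left)
    finally have 1: "(t + s) * \<phi> w \<le> t * \<phi> k + s * \<phi> m" .
    have "(t + s) *\<^sub>R w = t *\<^sub>R k + s *\<^sub>R m"
      unfolding w_def using * by (simp add: scaleR_add_right)
    then have "norm ((x + y) - (t + s) *\<^sub>R w) \<le> norm (x - t *\<^sub>R k) + norm (y - s *\<^sub>R m)"
      using norm_triangle_ineq[of "x - t *\<^sub>R k" "y - s *\<^sub>R m"] by (simp add: algebra_simps)
    then have "b * norm ((x + y) - (t + s) *\<^sub>R w) \<le> b * (norm (x - t *\<^sub>R k) + norm (y - s *\<^sub>R m))"
      using b by (rule mult_left_mono)
    then have "(t + s) * \<phi> w + b * norm ((x + y) - (t + s) *\<^sub>R w) \<le> a + c"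
      using 1 * by (simp add: distrib_left)
    then show "\<exists>d\<in>A (x + y). d \<le> a + c"
      using memA[of "t + s" w "x + y"] w * by (meson add_pos_pos)
  next
    fix x a and c :: real assume "a \<in> A x" and c: "0 < c"
    then obtain t k where tk: "0 < t" "k \<in> D" "a = t * \<phi> k + b * norm (x - t *\<^sub>R k)"
      unfolding A_def by blast
    have "norm (c *\<^sub>R x - (c * t) *\<^sub>R k) = c * norm (x - t *\<^sub>R k)"
      using c by (metis abs_of_pos norm_scaleR scaleR_diff_right scaleR_scaleR)
    then have "(c * t) * \<phi> k + b * norm (c *\<^sub>R x - (c * t) *\<^sub>R k) = c * a"
      using tk by (simp add: algebra_simps)
    then show "\<exists>d\<in>A (c *\<^sub>R x). d \<le> c * a"
      using memA[of "c * t" k "c *\<^sub>R x"] c tk by (metis mult_pos_pos order_refl)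
  qed
  obtain l where l: "linear l" "\<And>x. l x \<le> Inf (A x)"
    using Hahn_Banach_sublinear[OF sub] by blast
  have up: "l x \<le> t * \<phi> k + b * norm (x - t *\<^sub>R k)" if "0 < t" "k \<in> D" for x t k
    using l(2)[of x] cInf_lower[OF memA[OF that] bdd, of x] by linarith
  have le: "l x \<le> b * norm x" for x
    using up[OF zero_less_one D0, of x] \<phi>0 by simp
  have abs: "\<bar>l x\<bar> \<le> b * norm x" for x
    using le[of x] le[of "- x"] linear_neg[OF l(1), of x] by simp
  have bl: "bounded_linear l"
    using l(1) abs
    by (intro bounded_linear_intro[of _ b]) (auto simp: linear_add linear_scale mult.commute)
  have "l h \<le> \<phi> h" if "h \<in> D" for h using up[OF zero_less_one that, of h] by simp
  moreover have "norm (Blinfun l) \<le> b"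
    by (rule norm_blinfun_bound) (use b bl abs in \<open>auto simp: bounded_linear_Blinfun_apply\<close>)
  ultimately show thesis
    using that[of "Blinfun l"] bl by (simp add: bounded_linear_Blinfun_apply)
qed

section \<open>Ekeland's variational principle\<close>

text \<open>
  The relation \<open>v \<in> B x\<close> in the proof is a partial order, and \<open>u\<close> has to be minimal in it. Each
  iterate is chosen below its predecessor with a nearly minimal value of \<open>\<phi>\<close>; then all points
  below it lie close to it, so the lower sets shrink to the limit of the iterates. Lower
  semicontinuity of \<open>\<phi>\<close> on \<open>S\<close> is expressed by closed sublevel sets, which also covers
  closedness of \<open>S\<close> as far as the iterates need it.
\<close>

theorem Ekeland:
  fixes \<phi> :: "'a::complete_space \<Rightarrow> real"
  assumes closed: "\<And>c. closed {x\<in>S. \<phi> x \<le> c}"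
    and nonneg: "\<And>x. x \<in> S \<Longrightarrow> 0 \<le> \<phi> x" and x0: "x0 \<in> S" and \<alpha>: "0 < \<alpha>"
  obtains u where "u \<in> S" "\<phi> u + \<alpha> * dist u x0 \<le> \<phi> x0"
    "\<And>v. v \<in> S \<Longrightarrow> \<phi> u \<le> \<phi> v + \<alpha> * dist v u"
proof -
  define B where "B x = {v\<in>S. \<phi> v + \<alpha> * dist v x \<le> \<phi> x}" for x
  have self: "x \<in> S \<Longrightarrow> x \<in> B x" for x by (simp add: B_def)
  have trans: "v \<in> B x" if "v \<in> B w" "w \<in> B x" for v w x
  proof -
    have "\<alpha> * dist v x \<le> \<alpha> * (dist v w + dist w x)"
      using \<alpha> by (intro mult_left_mono dist_triangle) auto
    then show ?thesis using that by (auto simp: B_def distrib_left)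
  qed
  have bdd: "bdd_below (\<phi> ` B x)" for x
    by (rule bdd_belowI2[of _ 0]) (auto simp: B_def nonneg)
  have step: "\<exists>w. w \<in> B x \<and> (\<forall>v\<in>B x. \<phi> w \<le> \<phi> v + (1/2)^n)" if "x \<in> S" for x and n :: nat
  proof -
    have "Inf (\<phi> ` B x) < Inf (\<phi> ` B x) + (1/2)^n" by simp
    then obtain w where w: "w \<in> B x" "\<phi> w < Inf (\<phi> ` B x) + (1/2)^n"
      using cInf_lessD[of "\<phi> ` B x"] self[OF \<open>x \<in> S\<close>] by blast
    have "\<phi> w \<le> \<phi> v + (1/2)^n" if "v \<in> B x" for v
      using w(2) cINF_lower[OF bdd that] by linarith
    then show ?thesis using w(1) by blast
  qed
  obtain s where s0: "s 0 = x0"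
    and s: "\<And>n. s n \<in> S \<and> s (Suc n) \<in> B (s n) \<and> (\<forall>v\<in>B (s n). \<phi> (s (Suc n)) \<le> \<phi> v + (1/2)^n)"
  proof -
    have "\<exists>s. \<forall>n. (s n \<in> S \<and> (n = 0 \<longrightarrow> s n = x0)) \<and>
        (s (Suc n) \<in> B (s n) \<and> (\<forall>v\<in>B (s n). \<phi> (s (Suc n)) \<le> \<phi> v + (1/2)^n))"
    proof (rule dependent_nat_choice)
      show "\<exists>x. x \<in> S \<and> (0 = (0::nat) \<longrightarrow> x = x0)" using x0 by blast
      fix x and n :: nat assume "x \<in> S \<and> (n = 0 \<longrightarrow> x = x0)"
      then show "\<exists>y. (y \<in> S \<and> (Suc n = 0 \<longrightarrow> y = x0)) \<and>
          (y \<in> B x \<and> (\<forall>v\<in>B x. \<phi> y \<le> \<phi> v + (1/2)^n))"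
        using step[of x n] by (auto simp: B_def)
    qed
    then show thesis using that by blast
  qed
  have sB: "s m \<in> B (s n)" if "n \<le> m" for n m
    using that by (induction m rule: dec_induct) (use s self trans in blast)+
  have close: "\<alpha> * dist v (s (Suc n)) \<le> (1/2)^n" if "v \<in> B (s (Suc n))" for v n
  proof -
    have "v \<in> B (s n)" using trans[OF that] s by blast
    then have "\<phi> (s (Suc n)) \<le> \<phi> v + (1/2)^n" using s by blast
    moreover have "\<phi> v + \<alpha> * dist v (s (Suc n)) \<le> \<phi> (s (Suc n))" using that by (simp add: B_def)
    ultimately show ?thesis by linarith
  qed
  have small: "\<exists>N. \<forall>n\<ge>N. \<forall>v\<in>B (s n). dist v (s n) < e" if "0 < e" for e
  proof -
    obtain N where N: "(1/2::real)^N < \<alpha> * e"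
      using real_arch_pow_inv[of "\<alpha> * e" "1/2"] mult_pos_pos[OF \<alpha> \<open>0 < e\<close>] by auto
    have "dist v (s n) < e" if n: "Suc N \<le> n" and v: "v \<in> B (s n)" for n v
    proof -
      obtain m where m: "n = Suc m" "N \<le> m" using n by (cases n) auto
      have "\<alpha> * dist v (s n) \<le> (1/2)^m" using close v m by simp
      also have "\<dots> \<le> (1/2)^N" using m(2) by (intro power_decreasing) auto
      finally have "\<alpha> * dist v (s n) < \<alpha> * e" using N by linarith
      then show ?thesis using \<alpha> by simp
    qed
    then show ?thesis by blast
  qed
  have "Cauchy s"
  proof (rule CauchyI')
    fix e :: real assume "0 < e"
    then obtain N where "\<forall>n\<ge>N. \<forall>v\<in>B (s n). dist v (s n) < e" using small by blast
    then show "\<exists>M. \<forall>m\<ge>M. \<forall>n>m. dist (s m) (s n) < e"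
      using sB by (metis dist_commute less_imp_le)
  qed
  then obtain u where u: "s \<longlonglongrightarrow> u" using Cauchy_convergent convergent_def by blast
  have sub: "u \<in> S \<and> \<phi> u \<le> c" if "eventually (\<lambda>m. \<phi> (s m) \<le> c) sequentially" for c
  proof -
    have "u \<in> {x\<in>S. \<phi> x \<le> c}"
      by (rule Lim_in_closed_set[OF closed _ _ u])
         (use that s in \<open>auto elim: eventually_mono\<close>)
    then show ?thesis by blast
  qed
  have uB: "u \<in> B (s n)" for n
  proof -
    have lim: "(\<lambda>m. \<phi> (s n) - \<alpha> * dist (s m) (s n)) \<longlonglongrightarrow> \<phi> (s n) - \<alpha> * dist u (s n)"
      by (intro tendsto_intros u)
    have ev: "u \<in> S \<and> \<phi> u \<le> c" if c: "\<phi> (s n) - \<alpha> * dist u (s n) < c" for c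
    proof (rule sub)
      show "eventually (\<lambda>m. \<phi> (s m) \<le> c) sequentially"
        using order_tendstoD(2)[OF lim c] eventually_ge_at_top[of n]
      proof eventually_elim
        case (elim m)
        then show ?case using sB[OF elim(2)] by (simp add: B_def)
      qed
    qed
    have "u \<in> S" using ev[of "\<phi> (s n) - \<alpha> * dist u (s n) + 1"] by simp
    moreover have "\<phi> u \<le> \<phi> (s n) - \<alpha> * dist u (s n)" by (rule dense_ge) (use ev in blast)
    ultimately show ?thesis by (simp add: B_def)
  qed
  show thesis
  proof (rule that)
    show "u \<in> S" "\<phi> u + \<alpha> * dist u x0 \<le> \<phi> x0" using uB[of 0] s0 by (auto simp: B_def)
    fix v assume v: "v \<in> S"
    show "\<phi> u \<le> \<phi> v + \<alpha> * dist v u"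
    proof (rule ccontr)
      assume "\<not> ?thesis"
      then have "v \<in> B u" "v \<noteq> u" using v by (auto simp: B_def)
      then have vB: "v \<in> B (s n)" for n using trans uB by blast
      have "s \<longlonglongrightarrow> v"
        unfolding lim_sequentially
        using small vB by (metis dist_commute)
      then show False using u \<open>v \<noteq> u\<close> LIMSEQ_unique by blast
    qed
  qed
qed

section \<open>The dual pairing and the subdifferentials\<close>

lemma pairing_le:
  assumes "dual_of_separable \<iota>"
  shows "\<bar>blinfun_apply (\<iota> u) y\<bar> \<le> norm u * norm y"
proof -
  have norm_eq: "norm u = (SUP y\<in>cball 0 1. blinfun_apply (\<iota> u) y)"
    using assms by (simp add: dual_of_separable_def)
  have bdd: "bdd_above (blinfun_apply (\<iota> u) ` cball 0 1)"
  proof (rule bdd_aboveI2)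
    fix z :: 'b assume "z \<in> cball 0 1"
    then have "norm (\<iota> u) * norm z \<le> norm (\<iota> u) * 1" by (intro mult_left_mono) auto
    then show "blinfun_apply (\<iota> u) z \<le> norm (\<iota> u)"
      using norm_blinfun[of "\<iota> u" z] by simp
  qed
  have unit: "blinfun_apply (\<iota> u) z \<le> norm u" if "norm z \<le> 1" for z
    unfolding norm_eq using that by (intro cSUP_upper bdd) simp
  have le: "blinfun_apply (\<iota> u) z \<le> norm u * norm z" for z
  proof (cases "z = 0")
    case False
    have "blinfun_apply (\<iota> u) ((1 / norm z) *\<^sub>R z) \<le> norm u"
      using False by (intro unit) simp
    then show ?thesis using False by (simp add: blinfun.scaleR_right field_simps)
  qed simp
  show ?thesis using le[of y] le[of "- y"] by (simp add: blinfun.minus_right)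
qed

lemma embed_apply:
  assumes "dual_of_separable \<iota>"
  shows "blinfun_apply (embed \<iota> y) u = blinfun_apply (\<iota> u) y"
proof -
  have lin: "linear \<iota>" using assms by (simp add: dual_of_separable_def)
  have "bounded_linear (\<lambda>u. blinfun_apply (\<iota> u) y)"
    by (rule bounded_linear_intro[of _ "norm y"])
       (use pairing_le[OF assms, of _ y] in
         \<open>auto simp: linear_add[OF lin] linear_scale[OF lin] blinfun.add_left blinfun.scaleR_left\<close>)
  then show ?thesis by (simp add: embed_def bounded_linear_Blinfun_apply)
qed

lemma norm_imp_weakstar:
  assumes "dual_of_separable \<iota>" "v \<longlonglongrightarrow> u"
  shows "weakstar_tendsto \<iota> v u"
  unfolding weakstar_tendsto_def
proof
  fix y
  have "(\<lambda>k. blinfun_apply (embed \<iota> y) (v k)) \<longlonglongrightarrow> blinfun_apply (embed \<iota> y) u"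
    by (intro tendsto_intros assms)
  then show "(\<lambda>k. blinfun_apply (\<iota> (v k)) y) \<longlonglongrightarrow> blinfun_apply (\<iota> u) y"
    by (simp add: embed_apply[OF assms(1)])
qed

text \<open>
  The canonical embedding of the predual is isometric: testing with the element that represents a
  norming functional of \<open>y\<close> recovers \<open>norm y\<close>.
\<close>

lemma norm_predual_le_1:
  assumes \<iota>: "dual_of_separable \<iota>" and le: "\<And>u. blinfun_apply (\<iota> u) y \<le> norm u"
  shows "norm y \<le> 1"
proof -
  obtain l :: "'b \<Rightarrow>\<^sub>L real" where l: "norm l \<le> 1" "blinfun_apply l y = norm y"
    by (rule norming_functional)
  obtain u where u: "\<iota> u = l"
    using \<iota> by (metis bij_pointE dual_of_separable_def)
  have "norm u = (SUP y\<in>cball 0 1. blinfun_apply l y)"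
    using \<iota> u by (simp add: dual_of_separable_def)
  also have "\<dots> \<le> 1"
  proof (rule cSUP_least)
    fix z :: 'b assume "z \<in> cball 0 1"
    then have "norm l * norm z \<le> 1 * 1" using l(1) by (intro mult_mono) auto
    then show "blinfun_apply l z \<le> 1" using norm_blinfun[of l z] by simp
  qed simp
  finally show ?thesis using le[of u] u l(2) by simp
qed

lemma effective_domain_ereal:
  assumes "\<forall>u. 0 \<le> g u" "u \<in> effective_domain g"
  shows "g u = ereal (real_of_ereal (g u))"
  using assms by (cases "g u") (auto simp: effective_domain_def dest: spec[of _ u])

lemma convex_on_effective_domain:
  assumes nn: "\<forall>u. 0 \<le> g u" and conv: "convex_ereal g"
  shows "convex_on (effective_domain g) (\<lambda>u. real_of_ereal (g u))"
proof -
  have *: "(1 - t) *\<^sub>R x + t *\<^sub>R y \<in> effective_domain g \<and>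
      real_of_ereal (g ((1 - t) *\<^sub>R x + t *\<^sub>R y))
        \<le> (1 - t) * real_of_ereal (g x) + t * real_of_ereal (g y)"
    if "0 \<le> t" "t \<le> 1" "x \<in> effective_domain g" "y \<in> effective_domain g" for t x y
  proof -
    let ?w = "(1 - t) *\<^sub>R x + t *\<^sub>R y"
    have "g ?w \<le> ereal (1 - t) * g x + ereal t * g y"
      using conv that by (simp add: convex_ereal_def)
    also have "\<dots> = ereal ((1 - t) * real_of_ereal (g x) + t * real_of_ereal (g y))"
      by (subst (1) effective_domain_ereal[OF nn that(3)],
          subst (1) effective_domain_ereal[OF nn that(4)]) simp
    finally have le: "g ?w \<le> ereal ((1 - t) * real_of_ereal (g x) + t * real_of_ereal (g y))" .
    have dom: "?w \<in> effective_domain g"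
      using le by (auto simp: effective_domain_def intro: le_less_trans)
    show ?thesis using le dom effective_domain_ereal[OF nn dom] by (metis ereal_less_eq(3))
  qed
  show ?thesis
    by (rule convex_onI) (use * in \<open>auto simp: convex_alt\<close>)
qed

text \<open>
  The sum rule for \<open>gradf u + g + b * norm (\<cdot> - u)\<close> at a minimizer \<open>u\<close>: the subgradients of the
  norm at the origin have norm at most one. In the predual this rule is a hypothesis, applied with
  \<open>z = u\<close>; in the dual it follows from the sandwich lemma for the increments of
  \<open>gradf u + g\<close> at \<open>u\<close>.
\<close>

lemma slope_sq_le:
  fixes \<iota> :: "'u::banach \<Rightarrow> ('y::banach \<Rightarrow>\<^sub>L real)"
  assumes \<iota>: "dual_of_separable \<iota>" and g: "assumption_g \<iota> g"
    and rule: "X = Predual \<Longrightarrow> predual_sum_rule \<iota> g"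
    and u: "u \<in> effective_domain g" and b: "0 < b"
    and stat: "\<And>v. v \<in> effective_domain g \<Longrightarrow> real_of_ereal (g u)
      \<le> blinfun_apply (\<iota> (v - u)) (gradf u) + real_of_ereal (g v) + b * norm (v - u)"
  shows "slope_sq \<iota> X g gradf u \<le> ereal (b\<^sup>2)"
proof -
  define G where "G v = real_of_ereal (g v)" for v
  define D where "D = effective_domain g"
  have nn: "\<forall>u. 0 \<le> g u" and conv: "convex_ereal g" using g by (auto simp: assumption_g_def)
  have gG: "g v = ereal (G v)" if "v \<in> D" for v
    using effective_domain_ereal[OF nn] that by (simp add: G_def D_def)
  have ginf: "g v = \<infinity>" if "v \<notin> D" for v using that by (simp add: D_def effective_domain_def)
  have uD: "u \<in> D" using u by (simp add: D_def)
  have lin: "linear \<iota>" using \<iota> by (simp add: dual_of_separable_def)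
  have pair_diff: "blinfun_apply (\<iota> (v - u)) y = blinfun_apply (\<iota> v) y - blinfun_apply (\<iota> u) y" for v y
    by (simp add: linear_diff[OF lin] blinfun.diff_left)
  show ?thesis
  proof (cases X)
    case Predual
    have "ereal (blinfun_apply (\<iota> u) (gradf u)) + g u + ereal (b * norm (u - u))
        \<le> ereal (blinfun_apply (\<iota> v) (gradf u)) + g v + ereal (b * norm (v - u))" for v
    proof (cases "v \<in> D")
      case True
      then show ?thesis
        using stat[of v] by (simp add: gG uD pair_diff D_def[symmetric] G_def[symmetric])
    qed (simp add: ginf)
    then obtain \<xi> \<zeta> where \<xi>: "embed \<iota> \<xi> \<in> subdifferential g u"
      and \<zeta>: "embed \<iota> \<zeta> \<in> subdifferential (\<lambda>v. ereal (norm v)) (u - u)"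
      and sum: "0 = gradf u + \<xi> + b *\<^sub>R \<zeta>"
      using rule[OF Predual] u b unfolding predual_sum_rule_def by blast
    have "norm \<zeta> \<le> 1"
      using \<zeta> by (intro norm_predual_le_1[OF \<iota>]) (auto simp: subdifferential_def embed_apply[OF \<iota>])
    moreover have "gradf u + \<xi> = - (b *\<^sub>R \<zeta>)" using sum by (metis eq_neg_iff_add_eq_0)
    ultimately have "norm (gradf u + \<xi>) \<le> b" using b by simp
    then have "ereal ((norm (gradf u + \<xi>))\<^sup>2) \<le> ereal (b\<^sup>2)" by (simp add: power_mono)
    moreover have "slope_sq \<iota> X g gradf u \<le> ereal ((norm (gradf u + \<xi>))\<^sup>2)"
      unfolding slope_sq_def Predual using \<xi> by (auto intro: INF_lower)
    ultimately show ?thesis by (rule order_trans[rotated])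
  next
    case Dual
    define \<phi> where "\<phi> h = blinfun_apply (\<iota> h) (gradf u) + G (u + h) - G u" for h
    have cG: "convex_on D G"
      using convex_on_effective_domain[OF nn conv] by (simp add: D_def G_def[abs_def])
    have mem: "h \<in> (\<lambda>v. v - u) ` D \<longleftrightarrow> u + h \<in> D" for h
      by (auto intro!: image_eqI[of _ _ "u + h"])
    have "convex_on ((\<lambda>v. v - u) ` D) \<phi>"
    proof (rule convex_onI)
      show "convex ((\<lambda>v. v - u) ` D)"
        using convex_translation_subtract[OF convex_on_imp_convex[OF cG], of u] by simp
      fix t :: real and h k
      assume t: "0 < t" "t < 1" and hk: "h \<in> (\<lambda>v. v - u) ` D" "k \<in> (\<lambda>v. v - u) ` D"
      define w where "w = (1 - t) *\<^sub>R h + t *\<^sub>R k"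
      have "u + w = (1 - t) *\<^sub>R (u + h) + t *\<^sub>R (u + k)"
        by (simp add: w_def algebra_simps)
      then have "G (u + w) \<le> (1 - t) * G (u + h) + t * G (u + k)"
        using convex_onD[OF cG, of t "u + h" "u + k"] t hk[unfolded mem] by simp
      moreover have "blinfun_apply (\<iota> w) (gradf u)
          = (1 - t) * blinfun_apply (\<iota> h) (gradf u) + t * blinfun_apply (\<iota> k) (gradf u)"
        by (simp add: w_def linear_add[OF lin] linear_scale[OF lin] blinfun.add_left blinfun.scaleR_left)
      ultimately have "\<phi> w \<le> (1 - t) * \<phi> h + t * \<phi> k"
        by (simp add: \<phi>_def algebra_simps)
      then show "\<phi> ((1 - t) *\<^sub>R h + t *\<^sub>R k) \<le> (1 - t) * \<phi> h + t * \<phi> k"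
        by (simp add: w_def)
    qed
    moreover have "0 \<in> (\<lambda>v. v - u) ` D" using mem uD by simp
    moreover have "\<phi> 0 = 0" by (simp add: \<phi>_def linear_0[OF lin])
    moreover have "- b * norm h \<le> \<phi> h" if "h \<in> (\<lambda>v. v - u) ` D" for h
      using stat[of "u + h"] that[unfolded mem] by (simp add: \<phi>_def G_def D_def)
    ultimately obtain l where l: "norm l \<le> b" "\<And>h. h \<in> (\<lambda>v. v - u) ` D \<Longrightarrow> blinfun_apply l h \<le> \<phi> h"
      using convex_sandwich_norm[of "(\<lambda>v. v - u) ` D" \<phi> b] b by (metis less_imp_le)
    have "l - embed \<iota> (gradf u) \<in> subdifferential g u"
      unfolding subdifferential_def
    proof (intro CollectI allI)
      fix v
      show "g u + ereal (blinfun_apply (l - embed \<iota> (gradf u)) (v - u)) \<le> g v"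
      proof (cases "v \<in> D")
        case True
        then have "blinfun_apply l (v - u) \<le> \<phi> (v - u)" by (intro l(2)) simp
        then show ?thesis
          by (simp add: gG uD True blinfun.diff_left embed_apply[OF \<iota>] \<phi>_def)
      qed (simp add: ginf)
    qed
    then have "slope_sq \<iota> X g gradf u
        \<le> ereal ((norm (embed \<iota> (gradf u) + (l - embed \<iota> (gradf u))))\<^sup>2)"
      unfolding slope_sq_def Dual space_choice.case by (rule INF_lower)
    also have "\<dots> \<le> ereal (b\<^sup>2)" using l(1) by (simp add: power_mono)
    finally show ?thesis .
  qed
qed

section \<open>Quadratic growth\<close>

text \<open>
  Convexity of \<open>G\<close> bounds its difference quotient at \<open>u\<close> towards \<open>v\<close> by \<open>G v - G u\<close>. Dividing
  the local minimality along the segment by \<open>t\<close> therefore gives, in the limit, an inequality at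
  the possibly distant point \<open>v\<close>.
\<close>

lemma linearized_minimality:
  fixes f G :: "'u::banach \<Rightarrow> real"
  assumes conv: "convex_on D G" and u: "u \<in> D" and v: "v \<in> D"
    and deriv: "has_gateaux_derivative f f' u"
    and min: "\<forall>\<^sub>F t in at_right 0. f u + G u
      \<le> f (u + t *\<^sub>R (v - u)) + G (u + t *\<^sub>R (v - u)) + b * (t * norm (v - u))"
  shows "G u \<le> blinfun_apply f' (v - u) + G v + b * norm (v - u)"
proof -
  have lt_1: "\<forall>\<^sub>F t in at_right (0::real). t < 1"
    by (auto simp: eventually_at_right_field intro: exI[of _ 1])
  have "((\<lambda>t. (f (u + t *\<^sub>R (v - u)) - f u) / t) \<longlongrightarrow> blinfun_apply f' (v - u)) (at_right 0)"
    using deriv unfolding has_gateaux_derivative_def by (meson at_le subset_UNIV tendsto_mono)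
  moreover have "\<forall>\<^sub>F t in at_right 0.
      G u - G v - b * norm (v - u) \<le> (f (u + t *\<^sub>R (v - u)) - f u) / t"
    using min eventually_at_right_less[of "0::real"] lt_1
  proof eventually_elim
    fix t :: real
    assume m: "f u + G u \<le> f (u + t *\<^sub>R (v - u)) + G (u + t *\<^sub>R (v - u)) + b * (t * norm (v - u))"
      and t: "0 < t" and t1: "t < 1"
    have "G ((1 - t) *\<^sub>R u + t *\<^sub>R v) \<le> (1 - t) * G u + t * G v"
      using convex_onD[OF conv, of t u v] t t1 u v by simp
    then have "G (u + t *\<^sub>R (v - u)) \<le> (1 - t) * G u + t * G v" by (simp add: algebra_simps)
    then have "(G u - G v - b * norm (v - u)) * t \<le> f (u + t *\<^sub>R (v - u)) - f u"
      using m by (simp add: algebra_simps)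
    then show "G u - G v - b * norm (v - u) \<le> (f (u + t *\<^sub>R (v - u)) - f u) / t"
      using t by (simp add: pos_le_divide_eq)
  qed
  ultimately have "G u - G v - b * norm (v - u) \<le> blinfun_apply f' (v - u)"
    by (intro tendsto_lowerbound[of _ _ "at_right 0"]) auto
  then show ?thesis by simp
qed

text \<open>
  Weak* lower semicontinuity implies closedness in norm, as norm convergence implies weak*
  convergence. Since \<open>f\<close> is lower semicontinuous only on the domain of \<open>g\<close>, the limit has to be
  placed in this domain first; this uses \<open>f \<ge> 0\<close> to bound \<open>g\<close> along the sequence.
\<close>

lemma closed_sublevel:
  assumes \<iota>: "dual_of_separable \<iota>" and g: "assumption_g \<iota> g" and f: "assumption_f \<iota> f g gradf"
  shows "closed {v. objective f g v \<le> ereal c}"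
  unfolding closed_sequential_limits
proof (intro allI impI, elim conjE)
  fix v u assume v: "\<forall>n. v n \<in> {v. objective f g v \<le> ereal c}" and lim: "v \<longlonglongrightarrow> u"
  have ws: "weakstar_tendsto \<iota> v u" by (rule norm_imp_weakstar[OF \<iota> lim])
  have fnn: "0 \<le> f w" and gnn: "0 \<le> g w" for w
    using f g by (auto simp: assumption_f_def assumption_g_def)
  have le: "ereal (f (v n)) + g (v n) \<le> ereal c" for n using v by (auto simp: objective_def)
  have gle: "g (v n) \<le> ereal c" for n
    using le[of n] fnn[of "v n"] by (metis add_0 add_right_mono ereal_less_eq(5) order_trans)
  have "g (v n) < \<infinity>" for n
    by (rule le_less_trans[OF gle]) simp
  then have vD: "range v \<subseteq> effective_domain g"
    unfolding effective_domain_def by blast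
  have gl: "g u \<le> liminf (\<lambda>k. g (v k))"
    using g ws by (auto simp: assumption_g_def seq_weakstar_lsc_on_def)
  also have "\<dots> \<le> ereal c"
    using Liminf_mono[of "\<lambda>k. g (v k)" "\<lambda>_. ereal c" sequentially] gle by (simp add: Liminf_const)
  finally have uD: "u \<in> effective_domain g"
    by (auto simp: effective_domain_def intro: le_less_trans)
  have fl: "ereal (f u) \<le> liminf (\<lambda>k. ereal (f (v k)))"
    using f ws vD uD by (auto simp: assumption_f_def seq_weakstar_lsc_on_def)
  have "ereal (f u) + g u \<le> liminf (\<lambda>k. ereal (f (v k))) + liminf (\<lambda>k. g (v k))"
    by (intro add_mono fl gl)
  also have "\<dots> \<le> liminf (\<lambda>k. ereal (f (v k)) + g (v k))"
  proof (rule ereal_liminf_add_mono)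
    have "0 \<le> liminf (\<lambda>k. ereal (f (v k)))" "0 \<le> liminf (\<lambda>k. g (v k))"
      using fnn gnn by (auto intro!: Liminf_bounded)
    then show "\<not> (liminf (\<lambda>k. ereal (f (v k))) = \<infinity> \<and> liminf (\<lambda>k. g (v k)) = - \<infinity> \<or>
        liminf (\<lambda>k. ereal (f (v k))) = - \<infinity> \<and> liminf (\<lambda>k. g (v k)) = \<infinity>)" by auto
  qed
  also have "\<dots> \<le> ereal c"
    using Liminf_mono[of "\<lambda>k. ereal (f (v k)) + g (v k)" "\<lambda>_. ereal c" sequentially] le
    by (simp add: Liminf_const)
  finally show "u \<in> {v. objective f g v \<le> ereal c}" by (simp add: objective_def)
qed

theorem lemma6p8:
  fixes \<iota> :: "'u::banach \<Rightarrow> ('y::banach \<Rightarrow>\<^sub>L real)"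
    and f :: "'u \<Rightarrow> real" and g :: "'u \<Rightarrow> ereal" and gradf :: "'u \<Rightarrow> 'y"
    and ubar :: 'u and X :: space_choice and R lam \<eta> :: real
  assumes A1: "dual_of_separable \<iota>"
    and A2: "assumption_g \<iota> g"
    and A3: "assumption_f \<iota> f g gradf"
    and A4: "coercive (objective f g)"
    and "ubar \<in> effective_domain g"
    and "R > 0" and "lam > 0" and "\<eta> > 0"
    and "PLK \<iota> X f g gradf ubar R lam \<eta>"
    and "strict_minimizer_on (cball ubar R) (objective f g) ubar"
    and "X = Predual \<Longrightarrow> predual_sum_rule \<iota> g"
  shows "quadratic_growth (objective f g) ubar (R / 2) (min (1 / lam) (2 * \<eta> / (R / 2)\<^sup>2)) \<eta>"
  unfolding quadratic_growth_def
proof (intro ballI impI)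
  fix u0 assume u0: "u0 \<in> cball ubar (R / 2)"
    and u0\<eta>: "objective f g u0 \<le> objective f g ubar + ereal \<eta>"
  define D where "D = effective_domain g"
  define G where "G v = real_of_ereal (g v)" for v
  define j where "j v = f v + G v" for v
  define r where "r = norm (u0 - ubar)"
  let ?K = "cball ubar R"
  have nn: "\<forall>u. 0 \<le> g u" and conv: "convex_ereal g" using A2 by (auto simp: assumption_g_def)
  have cG: "convex_on D G"
    using convex_on_effective_domain[OF nn conv] by (simp add: D_def G_def[abs_def])
  have Jj: "objective f g v = ereal (j v)" if "v \<in> D" for v
    using effective_domain_ereal[OF nn] that
    by (metis D_def G_def j_def objective_def plus_ereal.simps(1))
  have Jinf: "objective f g v = \<infinity>" if "v \<notin> D" for v
    using that by (simp add: D_def effective_domain_def objective_def)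
  have ubarD: "ubar \<in> D" using assms(5) by (simp add: D_def)
  have u0D: "u0 \<in> D" using u0\<eta> Jinf[of u0] by (cases "u0 \<in> D") (auto simp: Jj ubarD)
  have r: "0 \<le> r" "r \<le> R / 2" using u0 by (auto simp: r_def dist_norm norm_minus_commute)
  have strict: "j ubar < j v" if "v \<in> ?K" "v \<in> D" "v \<noteq> ubar" for v
  proof -
    have "objective f g ubar < objective f g v"
      using assms(10) that by (simp add: strict_minimizer_on_def)
    then show ?thesis by (simp add: Jj ubarD that)
  qed
  then have jmin: "j ubar \<le> j v" if "v \<in> ?K" "v \<in> D" for v
    using that by (cases "v = ubar") (auto intro: less_imp_le)
  have u0K: "u0 \<in> ?K" using u0 \<open>R > 0\<close> by auto
  have key: "r\<^sup>2 / (2 * lam) \<le> j u0 - j ubar"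
  proof (rule ccontr)
    assume "\<not> ?thesis"
    then have less: "j u0 - j ubar < r\<^sup>2 / (2 * lam)" by simp
    then have r0: "0 < r" using jmin[OF u0K u0D] r(1) by (cases "r = 0") auto
    define \<phi> where "\<phi> v = sqrt (j v - j ubar)" for v
    have "\<phi> u0 / r < sqrt (1 / (2 * lam))"
    proof -
      have "\<phi> u0 < sqrt (r\<^sup>2 / (2 * lam))" using less by (simp add: \<phi>_def)
      also have "\<dots> = sqrt (1 / (2 * lam)) * r"
        using r0 by (simp add: real_sqrt_divide)
      finally show ?thesis using r0 by (simp add: pos_divide_less_eq)
    qed
    \<comment> \<open>The slope lies strictly between the average slope of \<open>\<phi>\<close> from \<open>ubar\<close> to \<open>u0\<close> and the slope
       guaranteed by the Polyak-Lojasiewicz-Kurdyka inequality.\<close>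
    then obtain \<alpha> where \<alpha>: "\<phi> u0 / r < \<alpha>" "\<alpha> < sqrt (1 / (2 * lam))" using dense by blast
    have \<phi>0: "0 \<le> \<phi> v" if "v \<in> ?K" "v \<in> D" for v using jmin[OF that] by (simp add: \<phi>_def)
    have \<alpha>0: "0 < \<alpha>"
      using \<alpha>(1) \<phi>0[OF u0K u0D] r0 by (meson divide_nonneg_pos le_less_trans)
    have \<phi>\<alpha>: "\<phi> u0 < \<alpha> * r" using \<alpha>(1) r0 by (simp add: pos_divide_less_eq)
    have "\<alpha>\<^sup>2 < (sqrt (1 / (2 * lam)))\<^sup>2" using \<alpha>(2) \<alpha>0 by (intro power_strict_mono) auto
    then have lam\<alpha>: "2 * lam * \<alpha>\<^sup>2 < 1" using \<open>lam > 0\<close> by (simp add: field_simps)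
    \<comment> \<open>On this set the objective is finite and the Polyak-Lojasiewicz-Kurdyka inequality holds.\<close>
    define S where "S = {v\<in>?K. v \<in> D \<and> j v \<le> j u0}"
    have "closed {v\<in>S. \<phi> v \<le> c}" for c
    proof (cases "0 \<le> c")
      case True
      have "{v\<in>S. \<phi> v \<le> c} =
          ?K \<inter> {v. objective f g v \<le> ereal (j u0)} \<inter> {v. objective f g v \<le> ereal (j ubar + c\<^sup>2)}"
        (is "?L = ?M")
      proof (rule set_eqI)
        fix v
        have "\<phi> v \<le> c \<longleftrightarrow> j v \<le> j ubar + c\<^sup>2" if "v \<in> ?K" "v \<in> D"
          using True jmin[OF that] unfolding \<phi>_def by (auto simp: real_sqrt_le_iff' real_le_lsqrt dest: sqrt_le_D)
        then show "v \<in> ?L \<longleftrightarrow> v \<in> ?M"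
          by (cases "v \<in> D") (auto simp: S_def Jj Jinf)
      qed
      then show ?thesis by (simp add: closed_Int closed_sublevel[OF A1 A2 A3])
    next
      case False
      then have "{v\<in>S. \<phi> v \<le> c} = {}" using \<phi>0 by (force simp: S_def)
      then show ?thesis by (simp only: closed_empty)
    qed
    moreover have "v \<in> S \<Longrightarrow> 0 \<le> \<phi> v" for v by (simp add: S_def \<phi>0)
    moreover have "u0 \<in> S" using u0K u0D by (simp add: S_def)
    ultimately obtain u where u: "u \<in> S" "\<phi> u + \<alpha> * dist u u0 \<le> \<phi> u0"
      and ek: "\<And>v. v \<in> S \<Longrightarrow> \<phi> u \<le> \<phi> v + \<alpha> * dist v u"
      using Ekeland[of S \<phi> u0 \<alpha>] \<alpha>0 by blast
    have uK: "u \<in> ?K" and uD: "u \<in> D" and ju: "j u \<le> j u0" using u(1) by (auto simp: S_def)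
    have "\<alpha> * dist u u0 < \<alpha> * r" using u(2) \<phi>\<alpha> \<phi>0[OF uK uD] by linarith
    then have dist: "dist u u0 < r" using \<alpha>0 by simp
    then have une: "u \<noteq> ubar" by (auto simp: r_def dist_norm norm_minus_commute)
    have "dist ubar u < R"
      using dist r dist_triangle[of ubar u u0] by (simp add: r_def dist_norm norm_minus_commute)
    then have "u \<in> ball ubar R" by simp
    have \<phi>u: "0 < \<phi> u" using strict[OF uK uD une] by (simp add: \<phi>_def)
    define b where "b = 2 * \<alpha> * \<phi> u"
    have b: "0 < b" using \<alpha>0 \<phi>u by (simp add: b_def)
    have stat: "G u \<le> blinfun_apply (\<iota> (v - u)) (gradf u) + G v + b * norm (v - u)" if v: "v \<in> D" for v
    proof -
      have "\<forall>\<^sub>F t in at_right 0. f u + G u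
        \<le> f (u + t *\<^sub>R (v - u)) + G (u + t *\<^sub>R (v - u)) + b * (t * norm (v - u))"
      proof -
        have "((\<lambda>t. u + t *\<^sub>R (v - u)) \<longlongrightarrow> u + 0 *\<^sub>R (v - u)) (at_right 0)" by (intro tendsto_intros)
        then have "\<forall>\<^sub>F t in at_right 0. u + t *\<^sub>R (v - u) \<in> ball ubar R"
          by (rule topological_tendstoD[OF _ open_ball]) (use \<open>u \<in> ball ubar R\<close> in simp)
        moreover have "((\<lambda>t. \<alpha> * (t * norm (v - u))) \<longlongrightarrow> \<alpha> * (0 * norm (v - u))) (at_right 0)"
          by (intro tendsto_intros)
        then have "\<forall>\<^sub>F t in at_right 0. \<alpha> * (t * norm (v - u)) < \<phi> u"
          using \<phi>u by (intro order_tendstoD) auto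
        moreover have "\<forall>\<^sub>F t in at_right (0::real). t < 1"
          by (auto simp: eventually_at_right_field intro: exI[of _ 1])
        moreover note eventually_at_right_less[of "0::real"]
        ultimately show ?thesis
        proof eventually_elim
          case (elim t)
          define w where "w = u + t *\<^sub>R (v - u)"
          have "w = (1 - t) *\<^sub>R u + t *\<^sub>R v" by (simp add: w_def algebra_simps)
          then have wD: "w \<in> D"
            using convexD_alt[OF convex_on_imp_convex[OF cG] uD v, of t] elim by simp
          have wK: "w \<in> ?K" using elim by (simp add: w_def)
          have dw: "dist w u = t * norm (v - u)" using elim by (simp add: w_def dist_norm)
          \<comment> \<open>Outside \<open>S\<close> the objective exceeds its value at \<open>u0\<close>, hence that at \<open>u\<close>.\<close>
          have "\<phi> u \<le> \<phi> w + \<alpha> * dist w u"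
          proof (cases "w \<in> S")
            case False
            then have "\<phi> u \<le> \<phi> w" using ju wD wK by (simp add: S_def \<phi>_def)
            then show ?thesis using \<alpha>0 by (simp add: add_increasing2)
          qed (rule ek)
          \<comment> \<open>Squaring needs \<open>\<alpha> * dist w u \<le> \<phi> u\<close>, which holds for small \<open>t\<close>.\<close>
          then have "(\<phi> u - \<alpha> * dist w u)\<^sup>2 \<le> (\<phi> w)\<^sup>2"
            using elim by (intro power_mono) (auto simp: dw)
          moreover have "b * dist w u = 2 * \<phi> u * (\<alpha> * dist w u)" by (simp add: b_def)
          ultimately have "(\<phi> u)\<^sup>2 - b * dist w u \<le> (\<phi> w)\<^sup>2"
            using zero_le_power2[of "\<alpha> * dist w u"] power2_diff[of "\<phi> u" "\<alpha> * dist w u"]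
            by linarith
          then have "j u - b * dist w u \<le> j w"
            using jmin[OF uK uD] jmin[OF wK wD] by (simp add: \<phi>_def)
          then show ?case by (simp add: j_def dw w_def[symmetric])
        qed
      qed
      moreover have "has_gateaux_derivative f (embed \<iota> (gradf u)) u"
        using A3 uD by (simp add: assumption_f_def D_def)
      ultimately show ?thesis
        using linearized_minimality[OF cG uD v, of f "embed \<iota> (gradf u)" b]
        by (simp add: embed_apply[OF A1])
    qed
    have slope: "slope_sq \<iota> X g gradf u \<le> ereal (b\<^sup>2)"
      using assms(11) uD b stat by (intro slope_sq_le[OF A1 A2]) (auto simp: D_def G_def)
    have "objective f g u \<le> objective f g ubar + ereal \<eta>"
      using ju u0\<eta> by (simp add: Jj uD u0D ubarD)
    then have "objective f g u - objective f g ubar \<le> ereal (lam / 2) * slope_sq \<iota> X g gradf u"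
      using assms(9) uK by (simp add: PLK_def)
    also have "\<dots> \<le> ereal (lam / 2) * ereal (b\<^sup>2)"
      using slope \<open>lam > 0\<close> by (intro ereal_mult_left_mono) auto
    finally have "(\<phi> u)\<^sup>2 \<le> lam / 2 * b\<^sup>2"
      using jmin[OF uK uD] by (simp add: Jj uD ubarD \<phi>_def)
    also have "\<dots> = (2 * lam * \<alpha>\<^sup>2) * (\<phi> u)\<^sup>2" by (simp add: b_def power2_eq_square)
    also have "\<dots> < 1 * (\<phi> u)\<^sup>2" using lam\<alpha> \<phi>u by (intro mult_strict_right_mono) auto
    finally show False by simp
  qed
  have "min (1 / lam) (2 * \<eta> / (R / 2)\<^sup>2) / 2 * r\<^sup>2 \<le> (1 / lam) / 2 * r\<^sup>2"
    by (intro mult_right_mono divide_right_mono) auto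
  also have "\<dots> = r\<^sup>2 / (2 * lam)" by simp
  also note key
  finally show "ereal (min (1 / lam) (2 * \<eta> / (R / 2)\<^sup>2) / 2 * (norm (u0 - ubar))\<^sup>2)
      \<le> objective f g u0 - objective f g ubar"
    by (simp add: Jj u0D ubarD r_def)
qed

end
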